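(* Let $n \ge 4$ be an integer, and let $d(n,4)$ denote the largest minimum weight among all binary linear complementary dual (LCD) $[n,4]$ codes. If $n \equiv 5,9,13 \pmod{15}$, then \[ d(n,4) = \left\lfloor \frac{8n}{15}\right\rfloor . \] If $n \equiv 2,3,4,6,10 \pmod{15}$, then \[ d(n,4)= \left\lfloor \frac{8n}{15}\right\rfloor-1 . \]
   Context: A binary $[n,k]$ code $C$ is a $k$-dimensional vector subspace of $\mathbb{F}_2^n$. The weight of a vector is its number of non-zero components, and the minimum weight of $C$ is the minimum weight of its non-zero vectors (codewords). The dual code is $C^\perp=\{x\in\mathbb{F}_2^n \mid x\cdot y=0 \text{ for all } y\in C\}$, where $x\cdot y$ is the standard inner product. The code $C$ is called linear complementary dual (LCD) if $C\cap C^\perp=\{\mathbf{0}_n\}$, where $\mathbf{0}_n$ is the zero vector of length $n$. For $1\le k\le n$, $d(n,k)$ denotes the largest minimum weight among all binary LCD $[n,k]$ codes. *)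

theory Defs
  imports Complex_Main "HOL-Library.Z2" "Jordan_Normal_Form.VS_Connect"
begin

text \<open>
  The field with two elements is \<^typ>\<open>bit\<close>, and its vectors of length \<open>n\<close> are the elements of
  \<open>carrier_vec n\<close>.
\<close>

definition binary_code :: "nat \<Rightarrow> nat \<Rightarrow> bit vec set \<Rightarrow> bool" where
  "binary_code n k C \<longleftrightarrow>
     VectorSpace.subspace class_ring C (module_vec TYPE(bit) n) \<and>
     vectorspace.dim class_ring ((module_vec TYPE(bit) n)\<lparr>carrier := C\<rparr>) = k"

definition weight :: "bit vec \<Rightarrow> nat" where
  "weight x = card {i. i < dim_vec x \<and> x $ i \<noteq> 0}"

text \<open>
  The set of weights below is always finite, and it is nonempty (so that \<^const>\<open>Min\<close> is
  meaningful) as soon as \<open>C\<close> has positive dimension.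
\<close>

definition min_weight :: "nat \<Rightarrow> bit vec set \<Rightarrow> nat" where
  "min_weight n C = Min (weight ` (C - {0\<^sub>v n}))"

definition dual_code :: "nat \<Rightarrow> bit vec set \<Rightarrow> bit vec set" where
  "dual_code n C = {x \<in> carrier_vec n. \<forall>y \<in> C. x \<bullet> y = 0}"

definition LCD :: "nat \<Rightarrow> bit vec set \<Rightarrow> bool" where
  "LCD n C \<longleftrightarrow> C \<inter> dual_code n C = {0\<^sub>v n}"

text \<open>
  There are only finitely many codes of length \<open>n\<close>, and for \<open>1 \<le> k \<le> n\<close> there is an LCD code of
  dimension \<open>k\<close> (the vectors supported on the first \<open>k\<close> coordinates), so the maximum exists in
  that range. Nothing is claimed about \<open>lcd_d n k\<close> outside of it.
\<close>

definition lcd_d :: "nat \<Rightarrow> nat \<Rightarrow> nat" where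
  "lcd_d n k = Max (min_weight n ` {C. binary_code n k C \<and> LCD n C})"

end

theory Submission
  imports Defs "HOL-Library.Product_Plus"
begin

text \<open>
  Both halves of the statement come from one bound and one family of codes.

  The upper bound is the Griesmer bound
  \<open>n \<ge> d + \<lceil>d/2\<rceil> + \<lceil>d/4\<rceil> + \<lceil>d/8\<rceil>\<close>, which holds for every binary code of dimension four
  and minimum weight \<open>d\<close>. In the residue classes of the statement it excludes every value above the
  claimed one. Writing a codeword as its support turns the bound into a
  statement about set families closed under symmetric difference (\<open>griesmer_set_family\<close>), proved
  by passing to the residual family outside a smallest nonempty member.

  For the lower bound, a code is described by the columns of a generator matrix \<open>G\<close>, a list of
  points of \<open>GF(2)\<^sup>4\<close>. The code is LCD iff the Gram matrix \<open>G G\<^sup>T\<close> is nonsingular, and both Gram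
  matrices and weights add up when lists of columns are concatenated. Hence a block of columns
  whose Gram matrix vanishes can be appended to an LCD code without destroying the LCD property
  (\<open>lcd_columns_append\<close>). Such blocks are all fifteen points of the projective space (every
  nonzero message has weight 8), the eight points off a plane (weight at least 4) and a zero
  column. The nonsingular starting blocks are the two nondegenerate quadrics of the projective
  space, elliptic with 5 points and weights at least 2, and hyperbolic with 9 points and weights at
  least 4, as well as the four unit vectors. Each block of fifteen points adds 15 to the length, 8
  to the minimum weight, and 15 to the Griesmer bound (\<open>griesmer_bound_add_simplex\<close>), so the
  comparison of the two bounds has to be made only for the finitely many lists of columns that
  remain without these blocks.
\<close>

section \<open>The Griesmer bound\<close>

text \<open>
  This is \<open>\<Sum>i<k. \<lceil>d / 2 ^ i\<rceil>\<close>, because iterated rounding up of halves agrees with rounding up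
  once. The recursion is the one that the residual code satisfies.
\<close>
fun griesmer_bound :: "nat \<Rightarrow> nat \<Rightarrow> nat" where
  "griesmer_bound 0 d = 0"
| "griesmer_bound (Suc k) d = d + griesmer_bound k ((d + 1) div 2)"

text \<open>
  All halvings of \<open>2 ^ k * q\<close> are exact, so it contributes \<open>2 ^ k * q + \<dots> + 2 * q + q\<close>. In terms
  of codes: a simplex code has length \<open>2 ^ Suc k - 1\<close> and constant weight \<open>2 ^ k\<close>, and appending
  \<open>q\<close> of them does not change how far a code is from the bound.
\<close>
lemma griesmer_bound_add_simplex:
  "griesmer_bound (Suc k) (d + 2 ^ k * q) = griesmer_bound (Suc k) d + (2 ^ Suc k - 1) * q"
proof (induction k arbitrary: d)
  case 0
  then show ?case by simp
next
  case (Suc k)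
  have half: "(d + 2 ^ Suc k * q + 1) div 2 = (d + 1) div 2 + 2 ^ k * q"
    by simp
  have "griesmer_bound (Suc (Suc k)) (d + 2 ^ Suc k * q) =
      d + 2 ^ Suc k * q + (griesmer_bound (Suc k) ((d + 1) div 2) + (2 ^ Suc k - 1) * q)"
    unfolding griesmer_bound.simps(2)[of "Suc k"] half Suc.IH ..
  also have "\<dots> = griesmer_bound (Suc (Suc k)) d + (2 ^ Suc k + (2 ^ Suc k - 1)) * q"
    unfolding griesmer_bound.simps(2)[of "Suc k"] distrib_right by linarith
  also have "(2::nat) ^ Suc k + (2 ^ Suc k - 1) = 2 ^ Suc (Suc k) - 1"
    by simp
  finally show ?case .
qed

text \<open>
  Let \<open>A\<close> be a smallest nonempty member. Cutting \<open>A\<close> out of all members identifies at most two of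
  them, since only \<open>{}\<close> and \<open>A\<close> lie inside \<open>A\<close>; so half of the family survives on \<open>S - A\<close>. A
  surviving nonempty member \<open>B - A\<close> has at least half the size of \<open>A\<close>: the sets \<open>B\<close> and
  \<open>sym_diff A B\<close> share it and split \<open>A\<close> between them, and both have at least \<open>card A\<close> elements.
\<close>
lemma griesmer_set_family:
  fixes F :: "'a set set"
  assumes "finite S" "F \<subseteq> Pow S" "2 ^ k \<le> card F"
    and "\<And>A B. A \<in> F \<Longrightarrow> B \<in> F \<Longrightarrow> sym_diff A B \<in> F"
    and "\<And>A. A \<in> F \<Longrightarrow> A \<noteq> {} \<Longrightarrow> d \<le> card A"
  shows "griesmer_bound k d \<le> card S"
  using assms
proof (induction k arbitrary: S F d)
  case 0
  then show ?case by simp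
next
  case (Suc k)
  note sub = \<open>F \<subseteq> Pow S\<close> and closed = Suc.prems(4) and wt = Suc.prems(5)
  have finF: "finite F"
    using sub \<open>finite S\<close> finite_subset by blast
  have fin: "finite A" if "A \<in> F" for A
    using that sub \<open>finite S\<close> finite_subset by blast
  have "\<not> F \<subseteq> {{}}"
  proof
    assume "F \<subseteq> {{}}"
    then have "card F \<le> card {{} :: 'a set}" by (intro card_mono) auto
    moreover have "(2::nat) \<le> 2 ^ Suc k" by simp
    ultimately show False using Suc.prems(3) by simp
  qed
  then obtain A0 where A0: "A0 \<in> F" "A0 \<noteq> {}" by blast
  obtain A where A: "A \<in> F" "A \<noteq> {}"
    and least: "\<And>B. B \<in> F \<Longrightarrow> B \<noteq> {} \<Longrightarrow> card A \<le> card B"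
    using ex_has_least_nat[of "\<lambda>B. B \<in> F \<and> B \<noteq> {}" A0 card] A0 by blast
  obtain a where a: "a \<in> A" using A by blast
  have below: "B = {} \<or> B = A" if "B \<in> F" "B \<subseteq> A" for B
    using that least[OF that(1)] fin[OF A(1)] card_seteq by blast
  let ?F' = "(\<lambda>B. B - A) ` F"
  \<comment> \<open>One point \<open>a\<close> of \<open>A\<close> tells the two members with the same trace outside \<open>A\<close> apart.\<close>
  have "inj_on (\<lambda>B. (B - A, a \<in> B)) F"
  proof (rule inj_onI)
    fix B B' assume B: "B \<in> F" "B' \<in> F" and eq: "(B - A, a \<in> B) = (B' - A, a \<in> B')"
    have "sym_diff B B' \<subseteq> A" using eq by blast
    then have "sym_diff B B' = {} \<or> sym_diff B B' = A"
      using below closed[OF B] by blast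
    then show "B = B'" using eq a by blast
  qed
  then have "card F \<le> card (?F' \<times> (UNIV :: bool set))"
    by (rule card_inj_on_le) (auto simp: finF)
  then have "card F \<le> 2 * card ?F'" by (simp add: card_cartesian_product)
  then have big: "2 ^ k \<le> card ?F'" using Suc.prems(3) by simp
  have "griesmer_bound k ((d + 1) div 2) \<le> card (S - A)"
  proof (rule Suc.IH[OF _ _ big])
    show "finite (S - A)" "?F' \<subseteq> Pow (S - A)" using \<open>finite S\<close> sub by auto
  next
    fix X Y assume "X \<in> ?F'" "Y \<in> ?F'"
    then obtain B C where B: "B \<in> F" "X = B - A" "C \<in> F" "Y = C - A" by blast
    then have "sym_diff X Y = sym_diff B C - A" by blast
    then show "sym_diff X Y \<in> ?F'" using closed B by blast
  next
    fix X assume "X \<in> ?F'" "X \<noteq> {}"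
    then obtain B where B: "B \<in> F" "X = B - A" by blast
    have ne: "B \<noteq> {}" "sym_diff A B \<noteq> {}" using B \<open>X \<noteq> {}\<close> by blast+
    have "card A \<le> card B" "card A \<le> card (sym_diff A B)"
      using least B ne closed A by blast+
    moreover have "card B = card (B - A) + card (A \<inter> B)"
      by (metis B(1) Int_commute add.commute card_Int_Diff fin)
    moreover have "card A = card (A - B) + card (A \<inter> B)"
      by (metis A(1) add.commute card_Int_Diff fin)
    moreover have "card (sym_diff A B) = card (A - B) + card (B - A)"
      by (rule card_Un_disjoint) (use fin A B in auto)
    moreover have "d \<le> card A" using wt A by blast
    ultimately show "(d + 1) div 2 \<le> card X" unfolding B(2) by linarith
  qed
  moreover have "card S = card A + card (S - A)"
    using A sub \<open>finite S\<close> by (metis PowD card_Diff_subset card_mono fin le_add_diff_inverse subsetD)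
  moreover have "d \<le> card A" using wt A by blast
  ultimately show ?case by simp
qed

section \<open>Codes over the field with two elements\<close>

lemma UNIV_bit: "(UNIV :: bit set) = {0, 1}"
  using bit_not_one_iff by blast

lemma card_UNIV_bit: "card (UNIV :: bit set) = 2"
  by (simp add: UNIV_bit)

text \<open>The basis criterion makes coefficient functions on a basis and vectors correspond.\<close>
lemma (in vectorspace) card_carrier_eq_power_dim:
  assumes "finite (carrier V)"
  shows "card (carrier V) = card (carrier K) ^ dim"
proof -
  have "fin_dim"
    unfolding fin_dim_def
    using assms span_closed in_own_span by (metis subset_antisym subset_refl subsetI)
  then obtain B where B: "finite B" "basis B" using finite_basis_exists by blast
  then have BV: "B \<subseteq> carrier V" by (simp add: basis_def)
  have unique: "\<exists>!a. a \<in> B \<rightarrow>\<^sub>E carrier K \<and> lincomb a B = v" if "v \<in> carrier V" for v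
    using basis_criterion[OF B(1) BV] B(2) that by blast
  have closed: "lincomb a B \<in> carrier V" if "a \<in> B \<rightarrow>\<^sub>E carrier K" for a
    using that by (intro lincomb_closed[OF BV]) auto
  have "bij_betw (\<lambda>a. lincomb a B) (B \<rightarrow>\<^sub>E carrier K) (carrier V)"
    unfolding bij_betw_def inj_on_def using unique closed by (auto simp: image_iff) metis+
  then have "card (carrier V) = card (B \<rightarrow>\<^sub>E carrier K)"
    by (simp add: bij_betw_same_card)
  also have "\<dots> = card (carrier K) ^ dim"
    using B by (simp add: card_PiE dim_basis)
  finally show ?thesis .
qed

lemma finite_carrier_vec_bit: "finite (carrier_vec n :: bit vec set)"
proof -
  have "carrier_vec n \<subseteq> vec_of_list ` {xs :: bit list. set xs \<subseteq> UNIV \<and> length xs = n}"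
  proof
    fix v :: "bit vec" assume "v \<in> carrier_vec n"
    then have "v = vec_of_list (list_of_vec v)" "length (list_of_vec v) = n"
      by (simp_all add: vec_list)
    then show "v \<in> vec_of_list ` {xs. set xs \<subseteq> UNIV \<and> length xs = n}" by blast
  qed
  moreover have "finite {xs :: bit list. set xs \<subseteq> UNIV \<and> length xs = n}"
    by (rule finite_lists_length_eq) (simp add: UNIV_bit)
  ultimately show ?thesis using finite_surj by blast
qed

lemma subspace_bit_iff:
  "VectorSpace.subspace class_ring C (module_vec TYPE(bit) n) \<longleftrightarrow>
     C \<subseteq> carrier_vec n \<and> 0\<^sub>v n \<in> C \<and> (\<forall>x\<in>C. \<forall>y\<in>C. x + y \<in> C)"
proof -
  have smult: "c \<cdot>\<^sub>v x = (if c = 0 then 0\<^sub>v n else x)" if "x \<in> carrier_vec n" for c :: bit and x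
    using that by (cases "c = 0") auto
  show ?thesis
    using vec_vs[where ?'a = bit, of n] vec_module[where ?'a = bit, of n] smult
    unfolding VectorSpace.subspace_def submodule_def
    by (auto simp: module_vec_simps)
qed

text \<open>
  Counting replaces dimension: a subspace over two elements has dimension \<open>k\<close> iff it has
  \<open>2 ^ k\<close> elements, so codes can be handled without bases from here on.
\<close>
lemma binary_code_iff:
  "binary_code n k C \<longleftrightarrow>
     C \<subseteq> carrier_vec n \<and> 0\<^sub>v n \<in> C \<and> (\<forall>x\<in>C. \<forall>y\<in>C. x + y \<in> C) \<and> card C = 2 ^ k"
proof -
  let ?V = "module_vec TYPE(bit) n"
  interpret vectorspace "class_ring :: bit ring" ?V by (rule vec_vs)
  have "card C = 2 ^ vectorspace.dim class_ring (?V\<lparr>carrier := C\<rparr>)"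
    if sub: "VectorSpace.subspace class_ring C ?V"
  proof -
    have "finite C"
      using sub finite_carrier_vec_bit finite_subset subspace_bit_iff by blast
    then show ?thesis
      using vectorspace.card_carrier_eq_power_dim[OF subspace_is_vs[OF sub]]
      by (simp add: card_UNIV_bit)
  qed
  then have "binary_code n k C \<longleftrightarrow>
      VectorSpace.subspace class_ring C ?V \<and> card C = 2 ^ k"
    unfolding binary_code_def by (metis power_inject_exp one_less_numeral_iff semiring_norm(76))
  then show ?thesis
    unfolding subspace_bit_iff by blast
qed

lemma griesmer_binary_code:
  assumes code: "binary_code n k C"
    and wt: "\<And>x. x \<in> C \<Longrightarrow> x \<noteq> 0\<^sub>v n \<Longrightarrow> d \<le> weight x"
  shows "griesmer_bound k d \<le> n"
proof -
  define supp where "supp x = {i. i < dim_vec x \<and> x $ i \<noteq> 0}" for x :: "bit vec"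
  note C = code[unfolded binary_code_iff]
  have dim: "dim_vec x = n" if "x \<in> C" for x using that C by auto
  have "inj_on supp C"
  proof (rule inj_onI)
    fix x y assume xy: "x \<in> C" "y \<in> C" "supp x = supp y"
    show "x = y"
    proof (rule eq_vecI)
      fix i assume "i < dim_vec y"
      then have "x $ i \<noteq> 0 \<longleftrightarrow> y $ i \<noteq> 0"
        using xy dim unfolding supp_def by (metis (lifting) mem_Collect_eq)
      then show "x $ i = y $ i" by (metis bit_not_zero_iff)
    qed (use xy dim in simp)
  qed
  then have card: "card (supp ` C) = 2 ^ k" using C by (simp add: card_image)
  have "griesmer_bound k d \<le> card {..<n}"
  proof (rule griesmer_set_family)
    show "finite {..<n}" "2 ^ k \<le> card (supp ` C)" using card by auto
    show "supp ` C \<subseteq> Pow {..<n}" using dim by (auto simp: supp_def)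
  next
    fix A B assume "A \<in> supp ` C" "B \<in> supp ` C"
    then obtain x y where xy: "x \<in> C" "y \<in> C" "A = supp x" "B = supp y" by blast
    have "p + q \<noteq> 0 \<longleftrightarrow> p \<noteq> q" for p q :: bit
      by (cases "p = 0"; cases "q = 0") auto
    then have "supp (x + y) = sym_diff A B"
      using xy dim by (auto simp: supp_def)
    then show "sym_diff A B \<in> supp ` C" using C xy by (metis imageI)
  next
    fix A assume "A \<in> supp ` C" "A \<noteq> {}"
    then obtain x where x: "x \<in> C" "A = supp x" by blast
    then have "x \<noteq> 0\<^sub>v n" using \<open>A \<noteq> {}\<close> by (auto simp: supp_def)
    then show "d \<le> card A" using wt x by (simp add: supp_def weight_def)
  qed
  then show ?thesis by simp
qed

text \<open>
  The set over which \<^const>\<open>lcd_d\<close> maximizes is finite, and the Griesmer bound for \<open>d + 1\<close> rules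
  out every larger minimum weight. It also forces \<open>k > 0\<close>, so that the minima are taken over
  nonempty sets.
\<close>
lemma lcd_d_eqI:
  assumes C: "binary_code n k C" "LCD n C"
    and wt: "\<And>x. x \<in> C \<Longrightarrow> x \<noteq> 0\<^sub>v n \<Longrightarrow> d \<le> weight x"
    and upper: "n < griesmer_bound k (d + 1)"
  shows "lcd_d n k = d"
proof -
  have kpos: "k > 0" using upper by (cases k) auto
  have fin: "finite D" if "binary_code n k D" for D
    using that finite_carrier_vec_bit finite_subset unfolding binary_code_iff by blast
  have ne: "D - {0\<^sub>v n} \<noteq> {}" if "binary_code n k D" for D
  proof
    assume "D - {0\<^sub>v n} = {}"
    then have "card D \<le> card {0\<^sub>v n :: bit vec}" by (intro card_mono) auto
    moreover have "(2::nat) ^ 1 \<le> 2 ^ k" using kpos by (intro power_increasing) auto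
    ultimately show False using that by (simp add: binary_code_iff)
  qed
  have le: "min_weight n D \<le> d" if D: "binary_code n k D" for D
  proof (rule ccontr)
    assume "\<not> min_weight n D \<le> d"
    then have heavy: "d + 1 \<le> weight x" if "x \<in> D" "x \<noteq> 0\<^sub>v n" for x
      using that fin[OF D] Min_le[of "weight ` (D - {0\<^sub>v n})" "weight x"]
      by (fastforce simp: min_weight_def)
    show False using griesmer_binary_code[OF D heavy] upper by simp
  qed
  have "d \<le> min_weight n C"
    unfolding min_weight_def using fin[OF C(1)] ne[OF C(1)] wt by (subst Min_ge_iff) auto
  then have min: "min_weight n C = d" using le[OF C(1)] by simp
  have "{D. binary_code n k D \<and> LCD n D} \<subseteq> Pow (carrier_vec n)"
    by (auto simp: binary_code_iff)
  then have "finite {D. binary_code n k D \<and> LCD n D}"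
    by (rule finite_subset) (simp add: finite_carrier_vec_bit)
  then show ?thesis
    unfolding lcd_d_def using C min le by (intro Max_eqI) auto
qed

section \<open>Codes of dimension four from lists of columns\<close>

type_synonym quad = "bit \<times> bit \<times> bit \<times> bit"

fun dot :: "quad \<Rightarrow> quad \<Rightarrow> bit" where
  "dot (a, b, c, d) (a', b', c', d') = a * a' + b * b' + c * c' + d * d'"

definition codeword :: "quad list \<Rightarrow> quad \<Rightarrow> bit vec" where
  "codeword xs u = vec_of_list (map (dot u) xs)"

definition column_weight :: "quad list \<Rightarrow> quad \<Rightarrow> nat" where
  "column_weight xs u = length (filter (\<lambda>x. dot u x \<noteq> 0) xs)"

text \<open>The bilinear form with matrix \<open>G G\<^sup>T\<close>, where \<open>G\<close> has the columns \<open>xs\<close>.\<close>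
definition gram :: "quad list \<Rightarrow> quad \<Rightarrow> quad \<Rightarrow> bit" where
  "gram xs u v = (\<Sum>x\<leftarrow>xs. dot u x * dot v x)"

definition lcd_columns :: "nat \<Rightarrow> quad list \<Rightarrow> bool" where
  "lcd_columns d xs \<longleftrightarrow> (\<forall>u. u \<noteq> 0 \<longrightarrow> d \<le> column_weight xs u \<and> (\<exists>v. gram xs u v \<noteq> 0))"

definition self_orthogonal_columns :: "nat \<Rightarrow> quad list \<Rightarrow> bool" where
  "self_orthogonal_columns d xs \<longleftrightarrow>
     (\<forall>u. u \<noteq> 0 \<longrightarrow> d \<le> column_weight xs u) \<and> (\<forall>u v. gram xs u v = 0)"

text \<open>The form of \<open>ys\<close> is zero, so the form of \<open>xs @ ys\<close> is that of \<open>xs\<close>, while weights add.\<close>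
lemma lcd_columns_append:
  "lcd_columns d xs \<Longrightarrow> self_orthogonal_columns e ys \<Longrightarrow> lcd_columns (d + e) (xs @ ys)"
  by (auto simp: lcd_columns_def self_orthogonal_columns_def column_weight_def gram_def
      intro!: add_mono simp del: add_bit_eq_xor)

lemma lcd_columns_append_replicate:
  assumes "lcd_columns d xs" "self_orthogonal_columns e ys"
  shows "lcd_columns (d + q * e) (xs @ concat (replicate q ys))"
proof (induction q)
  case 0
  then show ?case using assms by simp
next
  case (Suc q)
  have "concat (replicate (Suc q) ys) = concat (replicate q ys) @ ys"
    by (induction q) auto
  then show ?case
    using lcd_columns_append[OF Suc assms(2)] by (simp add: algebra_simps)
qed

lemma dot_add_left: "dot (u + v) x = dot u x + dot v x"
  by (cases u; cases v; cases x)
    (simp add: distrib_right add_ac del: add_bit_eq_xor mult_bit_eq_and)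

lemma codeword_add: "codeword xs (u + v) = codeword xs u + codeword xs v"
  by (rule eq_vecI) (simp_all add: codeword_def dot_add_left vec_of_list_index del: add_bit_eq_xor)

lemma weight_codeword: "weight (codeword xs u) = column_weight xs u"
  unfolding weight_def codeword_def column_weight_def length_filter_conv_card
  by (auto simp: vec_of_list_index intro!: arg_cong[where f = card])

lemma codeword_scalar_prod: "codeword xs u \<bullet> codeword xs v = gram xs u v"
  unfolding codeword_def gram_def scalar_prod_def
  by (simp add: vec_of_list_index sum_list_sum_nth atLeast0LessThan)

lemma card_quad: "card (UNIV :: quad set) = 16"
proof -
  have "(UNIV :: quad set) = {0, 1} \<times> {0, 1} \<times> {0, 1} \<times> {0, 1}"
    using UNIV_bit by (metis UNIV_Times_UNIV)
  also have "card \<dots> = 16" by (simp add: card_cartesian_product)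
  finally show ?thesis .
qed

lemma codeword_zero: "codeword xs 0 = 0\<^sub>v (length xs)"
proof (rule eq_vecI)
  have "dot 0 x = 0" for x by (cases x) (simp add: zero_prod_def)
  then show "codeword xs 0 $ i = 0\<^sub>v (length xs) $ i" if "i < dim_vec (0\<^sub>v (length xs))" for i
    using that by (simp add: codeword_def vec_of_list_index)
qed (simp add: codeword_def)

text \<open>
  The scalar product of two codewords is the Gram form of their messages. If the form is
  nondegenerate, then only the zero message has a codeword orthogonal to all codewords. This gives
  the LCD property, and also that distinct messages have distinct codewords, hence dimension 4.
\<close>
lemma lcd_columns_code:
  assumes "lcd_columns d xs"
  obtains C where "binary_code (length xs) 4 C" "LCD (length xs) C"
    "\<And>x. x \<in> C \<Longrightarrow> x \<noteq> 0\<^sub>v (length xs) \<Longrightarrow> d \<le> weight x"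
proof
  let ?n = "length xs"
  let ?C = "range (codeword xs)"
  have carrier: "codeword xs u \<in> carrier_vec ?n" for u
    unfolding codeword_def by (rule carrier_vecI) simp
  have zero: "0\<^sub>v ?n \<in> ?C"
    using codeword_zero[of xs, symmetric] by (rule range_eqI)
  have nondeg: "u = 0" if "\<And>v. codeword xs u \<bullet> codeword xs v = 0" for u
  proof (rule ccontr)
    assume "u \<noteq> 0"
    then obtain v where "gram xs u v \<noteq> 0"
      using assms unfolding lcd_columns_def by blast
    with that[of v] show False by (simp only: codeword_scalar_prod)
  qed
  have bit_self: "p + p = 0" for p :: bit
    by (cases "p = 0") simp_all
  have self: "v + v = 0\<^sub>v ?n" if "v \<in> carrier_vec ?n" for v :: "bit vec"
    by (rule eq_vecI)
      (use that bit_self in \<open>simp_all del: add_bit_eq_xor\<close>)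
  have char2: "w + w = 0" for w :: quad
    by (cases w) (simp only: add_Pair bit_self zero_prod_def)
  have "inj (codeword xs)"
  proof (rule injI)
    fix u v assume eq: "codeword xs u = codeword xs v"
    have "codeword xs (u + v) = 0\<^sub>v ?n"
      unfolding codeword_add eq by (rule self[OF carrier])
    then have "u + v = 0"
      using carrier by (intro nondeg) simp
    moreover have "u = u + v + v"
      by (simp only: add.assoc char2 add_0_right)
    ultimately show "u = v"
      by (simp only: add_0_left)
  qed
  then have card: "card ?C = 2 ^ 4"
    unfolding card_image[OF \<open>inj (codeword xs)\<close>] card_quad by simp
  have add: "x + y \<in> ?C" if xy: "x \<in> ?C" "y \<in> ?C" for x y
  proof -
    obtain u v where "x = codeword xs u" "y = codeword xs v" using xy by blast
    then have "x + y = codeword xs (u + v)" by (simp only: codeword_add)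
    then show ?thesis by (rule range_eqI)
  qed
  have "?C \<subseteq> carrier_vec ?n" using carrier by (rule image_subsetI)
  then show "binary_code ?n 4 ?C"
    unfolding binary_code_iff by (intro conjI ballI zero card add)
  show "LCD ?n ?C"
    unfolding LCD_def
  proof (rule equalityI)
    show "?C \<inter> dual_code ?n ?C \<subseteq> {0\<^sub>v ?n}"
    proof
      fix x assume x: "x \<in> ?C \<inter> dual_code ?n ?C"
      then obtain u where u: "x = codeword xs u" by blast
      have "codeword xs u \<bullet> codeword xs v = 0" for v
        using x unfolding dual_code_def u by blast
      then have "u = 0" by (rule nondeg)
      then show "x \<in> {0\<^sub>v ?n}" unfolding u by (simp only: codeword_zero singletonI)
    qed
    have "0\<^sub>v ?n \<bullet> y = 0" if "y \<in> ?C" for y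
      using that carrier scalar_prod_left_zero by blast
    then show "{0\<^sub>v ?n} \<subseteq> ?C \<inter> dual_code ?n ?C"
      unfolding dual_code_def using zero zero_carrier_vec by blast
  qed
  show "d \<le> weight x" if x: "x \<in> ?C" "x \<noteq> 0\<^sub>v ?n" for x
  proof -
    obtain u where u: "x = codeword xs u" using x(1) by blast
    have "u \<noteq> 0"
    proof
      assume "u = 0"
      with x(2) show False by (simp add: u codeword_zero)
    qed
    then show ?thesis
      using assms unfolding u weight_codeword lcd_columns_def by blast
  qed
qed

section \<open>Quadrics and affine spaces in the projective space of dimension three over GF(2)\<close>

definition quads :: "quad list" where
  "quads = [(a, b, c, d). a \<leftarrow> [0, 1], b \<leftarrow> [0, 1], c \<leftarrow> [0, 1], d \<leftarrow> [0, 1]]"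

definition projective_points :: "quad list" where
  "projective_points = filter (\<lambda>x. x \<noteq> 0) quads"

text \<open>
  The columns of the extended Hamming code of length 8, which is self-dual.
\<close>
definition affine_points :: "quad list" where
  "affine_points = filter (\<lambda>(a, b, c, d). a = 1) quads"

text \<open>
  A plane meets the hyperbolic quadric in 3 or 5 of its 9 points and the elliptic quadric in 1 or 3
  of its 5 points; the points off the plane make up the weight of a codeword.
\<close>
definition hyperbolic_quadric :: "quad list" where
  "hyperbolic_quadric = filter (\<lambda>(a, b, c, d). a * b + c * d = 0) projective_points"

text \<open>
  The summand \<open>c * c + c * d + d * d\<close> vanishes only for \<open>c = d = 0\<close>, which makes the form elliptic.
\<close>
definition elliptic_quadric :: "quad list" where
  "elliptic_quadric = filter (\<lambda>(a, b, c, d). a * b + c * c + c * d + d * d = 0) projective_points"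

definition unit_points :: "quad list" where
  "unit_points = [(1, 0, 0, 0), (0, 1, 0, 0), (0, 0, 1, 0), (0, 0, 0, 1)]"

lemma quads_eq:
  "quads =
    [(0,0,0,0), (0,0,0,1), (0,0,1,0), (0,0,1,1), (0,1,0,0), (0,1,0,1), (0,1,1,0), (0,1,1,1),
     (1,0,0,0), (1,0,0,1), (1,0,1,0), (1,0,1,1), (1,1,0,0), (1,1,0,1), (1,1,1,0), (1,1,1,1)]"
  by (simp add: quads_def)

lemmas point_defs = quads_eq projective_points_def affine_points_def hyperbolic_quadric_def
  elliptic_quadric_def unit_points_def

lemma all_bit: "(\<forall>x :: bit. P x) \<longleftrightarrow> P 0 \<and> P 1"
  by (metis bit_not_zero_iff)

text \<open>
  By linearity nothing is lost in testing a message against unit vectors only, and the finite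
  verification for a given list of columns becomes short.
\<close>
lemma lcd_columnsI:
  assumes "\<forall>u. u \<noteq> 0 \<longrightarrow> d \<le> column_weight xs u \<and> (\<exists>v \<in> set unit_points. gram xs u v \<noteq> 0)"
  shows "lcd_columns d xs"
  using assms unfolding lcd_columns_def by blast

lemma length_points:
  "length projective_points = 15" "length affine_points = 8" "length hyperbolic_quadric = 9"
  "length elliptic_quadric = 5" "length unit_points = 4"
  by (simp_all add: point_defs zero_prod_def)

lemma hyperbolic_quadric_lcd: "lcd_columns 4 hyperbolic_quadric"
  by (rule lcd_columnsI)
    (simp add: split_paired_All all_bit column_weight_def gram_def zero_prod_def point_defs)

lemma elliptic_quadric_lcd: "lcd_columns 2 elliptic_quadric"
  by (rule lcd_columnsI)
    (simp add: split_paired_All all_bit column_weight_def gram_def zero_prod_def point_defs)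

lemma unit_points_lcd: "lcd_columns 1 unit_points"
  by (rule lcd_columnsI)
    (simp add: split_paired_All all_bit column_weight_def gram_def zero_prod_def point_defs)

lemma projective_points_self_orthogonal: "self_orthogonal_columns 8 projective_points"
  unfolding self_orthogonal_columns_def
  by (simp add: split_paired_All all_bit column_weight_def gram_def zero_prod_def point_defs)

lemma affine_points_self_orthogonal: "self_orthogonal_columns 4 affine_points"
  unfolding self_orthogonal_columns_def
  by (simp add: split_paired_All all_bit column_weight_def gram_def zero_prod_def point_defs)

lemma zero_column_self_orthogonal: "self_orthogonal_columns 0 [0]"
  unfolding self_orthogonal_columns_def
  by (simp add: split_paired_All all_bit gram_def zero_prod_def)

lemma griesmer_bound_4: "griesmer_bound 4 d =
    d + ((d + 1) div 2 + (((d + 1) div 2 + 1) div 2 + (((d + 1) div 2 + 1) div 2 + 1) div 2))"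
  by (simp add: numeral_eq_Suc)

lemma lcd_d_4_eqI:
  assumes xs: "lcd_columns d xs" and upper: "length xs < griesmer_bound 4 (d + 1)"
    and n: "n = 15 * q + length xs"
  shows "lcd_d n 4 = d + 8 * q"
proof -
  let ?ys = "xs @ concat (replicate q projective_points)"
  have len: "length ?ys = n"
    by (simp add: n length_concat sum_list_replicate length_points)
  have "lcd_columns (d + q * 8) ?ys"
    by (rule lcd_columns_append_replicate[OF xs projective_points_self_orthogonal])
  then obtain C where C: "binary_code n 4 C" "LCD n C"
    "\<And>x. x \<in> C \<Longrightarrow> x \<noteq> 0\<^sub>v n \<Longrightarrow> d + q * 8 \<le> weight x"
    by (rule lcd_columns_code[of "d + q * 8" ?ys, unfolded len]) blast
  have "griesmer_bound 4 (d + q * 8 + 1) = griesmer_bound 4 (d + 1) + 15 * q"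
    using griesmer_bound_add_simplex[of 3 "d + 1" q] by (simp add: ac_simps)
  then have "n < griesmer_bound 4 (d + q * 8 + 1)"
    using upper n by linarith
  with C have "lcd_d n 4 = d + q * 8"
    by (rule lcd_d_eqI)
  then show ?thesis by simp
qed

theorem theorem1:
  fixes n :: nat
  assumes "n \<ge> 4"
  shows "(n mod 15 \<in> {5, 9, 13} \<longrightarrow> int (lcd_d n 4) = \<lfloor>8 * real n / 15\<rfloor>) \<and>
         (n mod 15 \<in> {2, 3, 4, 6, 10} \<longrightarrow> int (lcd_d n 4) = \<lfloor>8 * real n / 15\<rfloor> - 1)"
proof -
  define q where "q = n div 15"
  have n: "n = 15 * q + n mod 15"
    by (simp add: q_def)
  note eqI = lcd_d_4_eqI[where n = n] and simps = length_points griesmer_bound_4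
  note zero = lcd_columns_append[OF _ zero_column_self_orthogonal]
  note affine = lcd_columns_append[OF _ affine_points_self_orthogonal]
  \<comment> \<open>The summands of each value are the weights of the blocks, in the order of concatenation.\<close>
  have r5: "lcd_d n 4 = 2 + 8 * q" if "n mod 15 = 5"
    by (rule eqI[OF elliptic_quadric_lcd]) (use n that in \<open>simp_all add: simps\<close>)
  have r6: "lcd_d n 4 = 2 + 0 + 8 * q" if "n mod 15 = 6"
    by (rule eqI[OF zero[OF elliptic_quadric_lcd]]) (use n that in \<open>simp_all add: simps\<close>)
  have r13: "lcd_d n 4 = 2 + 4 + 8 * q" if "n mod 15 = 13"
    by (rule eqI[OF affine[OF elliptic_quadric_lcd]]) (use n that in \<open>simp_all add: simps\<close>)
  have r9: "lcd_d n 4 = 4 + 8 * q" if "n mod 15 = 9"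
    by (rule eqI[OF hyperbolic_quadric_lcd]) (use n that in \<open>simp_all add: simps\<close>)
  have r10: "lcd_d n 4 = 4 + 0 + 8 * q" if "n mod 15 = 10"
    by (rule eqI[OF zero[OF hyperbolic_quadric_lcd]]) (use n that in \<open>simp_all add: simps\<close>)
  have r4: "lcd_d n 4 = 1 + 8 * q" if "n mod 15 = 4"
    by (rule eqI[OF unit_points_lcd]) (use n that in \<open>simp_all add: simps\<close>)
  \<comment> \<open>The starting blocks for the residues 2 and 3 have lengths 17 and 18, hence \<open>q - 1\<close> repetitions.\<close>
  have r2: "lcd_d n 4 = 4 + 4 + 8 * (q - 1)" if "n mod 15 = 2"
    by (rule eqI[OF affine[OF hyperbolic_quadric_lcd]])
      (use n that assms in \<open>simp_all add: simps\<close>)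
  have r3: "lcd_d n 4 = 4 + 4 + 0 + 8 * (q - 1)" if "n mod 15 = 3"
    by (rule eqI[OF zero[OF affine[OF hyperbolic_quadric_lcd]]])
      (use n that assms in \<open>simp_all add: simps\<close>)
  have "8 * n = 8 * (n mod 15) + 8 * q * 15"
    using n by simp
  then have "8 * n div 15 = 8 * q + 8 * (n mod 15) div 15"
    by (simp only: div_mult_self3 div_mult_self1 flip: add.commute)
  then have floor: "\<lfloor>8 * real n / 15\<rfloor> = int (8 * q + 8 * (n mod 15) div 15)"
    using floor_divide_of_nat_eq[of "8 * n" 15, where ?'a = real] by simp
  \<comment> \<open>\<open>n \<ge> 4\<close> excludes \<open>q = 0\<close> here, so that \<open>8 * (q - 1)\<close> is a true difference.\<close>
  have "1 \<le> q" if "n mod 15 \<in> {2, 3}"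
    using n that assms by auto
  then show ?thesis
    unfolding floor using r2 r3 r4 r5 r6 r9 r10 r13 by auto
qed

end
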